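(* Let $x,y,z\in\mathbb{Z}[\tau]$ satisfy $x^2+y^2=z^2$. Then there exist $l,m,n\in\mathbb{Z}[\tau]$ such that either $$x=\pm 2lmn,\qquad y=l(m^2-n^2),\qquad z=l(m^2+n^2)$$ for some choice of the sign, or the same holds with the roles of $x$ and $y$ interchanged, i.e. $$y=\pm 2lmn,\qquad x=l(m^2-n^2),\qquad z=l(m^2+n^2)$$ for some choice of the sign.
   Context: $\tau=\frac{1+\sqrt5}{2}$ and $\mathbb{Z}[\tau]=\{m+n\tau \mid m,n\in\mathbb{Z}\}$. A Pythagorean triple in $\mathbb{Z}[\tau]$ is a triple $(x,y,z)$ of elements of $\mathbb{Z}[\tau]$ with $x^2+y^2=z^2$. *)

theory Defs imports Complex_Main begin

definition tau :: real where
  "tau = (1 + sqrt 5) / 2"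

definition Z_tau :: "real set" where
  "Z_tau = {of_int m + of_int n * tau | m n :: int. True}"

end

theory Submission imports Defs begin

text \<open>
  If \<open>x\<^sup>2 + y\<^sup>2 = z\<^sup>2\<close>, then \<open>(x + y + z)\<^sup>2\<close> is even. As 2 is inert in \<open>\<int>[\<tau>]\<close>,
  \<open>x + y + z = 2w\<close>, and then \<open>x y = 2w(x + y) - 2w\<^sup>2\<close> shows that one leg, say \<open>x\<close>, is even.
  Now \<open>(x/2)\<^sup>2 = ((z + y)/2) ((z - y)/2)\<close> with all factors in \<open>\<int>[\<tau>]\<close>. Writing
  \<open>(z + y)/2 = g m\<close> and \<open>x/2 = g n\<close> with \<open>m\<close>, \<open>n\<close> coprime (\<open>\<int>[\<tau>]\<close> is norm-Euclidean), \<open>m\<close> divides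
  \<open>g\<close>, and \<open>l = g/m\<close> gives \<open>(z + y)/2 = l m\<^sup>2\<close>, \<open>(z - y)/2 = l n\<^sup>2\<close>, \<open>x/2 = l m n\<close>.
\<close>

lemma tau_square: "tau * tau = tau + 1"
proof -
  have "sqrt 5 * sqrt 5 = 5" by simp
  then show ?thesis unfolding tau_def by (simp add: field_simps)
qed

lemma tau_mult:
  fixes a b c d :: real
  shows "(a + b * tau) * (c + d * tau) = (a * c + b * d) + (a * d + b * c + b * d) * tau"
proof -
  have "(a + b * tau) * (c + d * tau) = a * c + (a * d + b * c) * tau + b * d * (tau * tau)"
    by (simp add: algebra_simps)
  then show ?thesis unfolding tau_square by (simp add: algebra_simps)
qed

lemma Z_tau_I: "of_int m + of_int n * tau \<in> Z_tau"
  unfolding Z_tau_def by blast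

lemma Z_tau_E:
  assumes "x \<in> Z_tau"
  obtains m n :: int where "x = of_int m + of_int n * tau"
  using assms unfolding Z_tau_def by blast

lemma Z_tau_of_int [simp]: "of_int k \<in> Z_tau"
  using Z_tau_I[of k 0] by simp

lemma Z_tau_0 [simp]: "0 \<in> Z_tau" and Z_tau_1 [simp]: "1 \<in> Z_tau" and Z_tau_2 [simp]: "2 \<in> Z_tau"
  using Z_tau_of_int[of 0] Z_tau_of_int[of 1] Z_tau_of_int[of 2] by simp_all

lemma Z_tau_add [simp]: "x \<in> Z_tau \<Longrightarrow> y \<in> Z_tau \<Longrightarrow> x + y \<in> Z_tau"
proof (elim Z_tau_E)
  fix a b c d :: int
  assume "x = of_int a + of_int b * tau" "y = of_int c + of_int d * tau"
  then have "x + y = of_int (a + c) + of_int (b + d) * tau" by (simp add: algebra_simps)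
  then show ?thesis by (metis Z_tau_I)
qed

lemma Z_tau_mult [simp]: "x \<in> Z_tau \<Longrightarrow> y \<in> Z_tau \<Longrightarrow> x * y \<in> Z_tau"
proof (elim Z_tau_E)
  fix a b c d :: int
  assume "x = of_int a + of_int b * tau" "y = of_int c + of_int d * tau"
  then have "x * y = of_int (a * c + b * d) + of_int (a * d + b * c + b * d) * tau"
    by (simp add: tau_mult)
  then show ?thesis by (metis Z_tau_I)
qed

lemma Z_tau_diff [simp]: "x \<in> Z_tau \<Longrightarrow> y \<in> Z_tau \<Longrightarrow> x - y \<in> Z_tau"
  using Z_tau_add[of x "of_int (- 1) * y"] Z_tau_mult[OF Z_tau_of_int[of "- 1"]] by simp

lemma Z_tau_power [simp]: "x \<in> Z_tau \<Longrightarrow> x ^ k \<in> Z_tau"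
  by (induction k) auto

text \<open>The field norm of \<open>m + n * tau\<close>, its product with the conjugate obtained
  from \<open>tau\<close> \<mapsto> \<open>1 - tau\<close>. Taking integer coordinates makes parity
  and induction on its size directly available.\<close>

definition tau_norm :: "int \<Rightarrow> int \<Rightarrow> int" where
  "tau_norm m n = m * m + m * n - n * n"

text \<open>This is the inertness of 2: the form has no nontrivial zero modulo 2.\<close>

lemma even_tau_norm: "even (tau_norm m n) \<longleftrightarrow> even m \<and> even n"
  unfolding tau_norm_def by auto

text \<open>Infinite descent: a zero of the form has even coordinates, and halving them gives a
  smaller zero.\<close>

lemma tau_norm_eq_0: "tau_norm m n = 0 \<Longrightarrow> m = 0 \<and> n = 0"
proof (induction "nat (\<bar>m\<bar> + \<bar>n\<bar>)" arbitrary: m n rule: less_induct)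
  case less
  then obtain a b where ab: "m = 2 * a" "n = 2 * b"
    by (metis dvd_0_right even_tau_norm evenE)
  with less.prems have "tau_norm a b = 0" by (simp add: tau_norm_def)
  moreover have "\<bar>a\<bar> + \<bar>b\<bar> < \<bar>m\<bar> + \<bar>n\<bar>" if "m \<noteq> 0 \<or> n \<noteq> 0"
    using that ab by linarith
  ultimately show ?case using less.hyps[of a b] ab by fastforce
qed

lemma tau_conj_mult:
  "of_int (tau_norm m n) = (of_int (m + n) - of_int n * tau) * (of_int m + of_int n * tau)"
  using tau_mult[of "of_int (m + n)" "- of_int n" "of_int m" "of_int n"]
  by (simp add: tau_norm_def algebra_simps)

text \<open>If \<open>x\<close> has even norm, it is divisible by 2. Otherwise, multiplying
  \<open>x * y = 2 * k\<close> by the conjugate \<open>c\<close> of \<open>x\<close> shows that an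
  odd integer times \<open>y\<close> is divisible by 2, hence \<open>y\<close> is.\<close>

lemma two_prime_Z_tau:
  assumes x: "x \<in> Z_tau" and y: "y \<in> Z_tau" and xy: "x * y = 2 * k" and k: "k \<in> Z_tau"
  shows "(\<exists>h\<in>Z_tau. x = 2 * h) \<or> (\<exists>h\<in>Z_tau. y = 2 * h)"
proof -
  obtain m n where mn: "x = of_int m + of_int n * tau" by (rule Z_tau_E[OF x])
  show ?thesis
  proof (cases "even (tau_norm m n)")
    case True
    then obtain a b where "m = 2 * a" "n = 2 * b" by (metis even_tau_norm evenE)
    then have "x = 2 * (of_int a + of_int b * tau)" by (simp add: mn)
    then show ?thesis using Z_tau_I by blast
  next
    case False
    then obtain j where j: "tau_norm m n = 2 * j + 1" by (rule oddE)
    define c where "c = of_int (m + n) - of_int n * tau"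
    have c: "c \<in> Z_tau" unfolding c_def using Z_tau_I[of "m + n" "- n"] by simp
    have "(2 * of_int j + 1) * y = c * (x * y)"
      using tau_conj_mult[of m n] by (simp add: j mn c_def)
    then have "y = 2 * (c * k - of_int j * y)" by (simp add: xy algebra_simps)
    then show ?thesis using c k y by (meson Z_tau_diff Z_tau_mult Z_tau_of_int)
  qed
qed

lemma int_nearest_quotient:
  fixes u N :: int
  assumes "N \<noteq> 0"
  shows "\<exists>q. 2 * \<bar>u - q * N\<bar> \<le> \<bar>N\<bar>"
proof -
  have r: "\<bar>real_of_int u / real_of_int N - of_int (round (real_of_int u / real_of_int N))\<bar> \<le> 1 / 2"
    using of_int_round_abs_le[of "real_of_int u / real_of_int N"] by (simp add: abs_minus_commute)
  define q where "q = round (real_of_int u / real_of_int N)"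
  have "\<bar>real_of_int u - of_int q * of_int N\<bar> =
      \<bar>real_of_int u / real_of_int N - of_int q\<bar> * \<bar>of_int N\<bar>"
    using assms by (simp add: abs_mult[symmetric] algebra_simps)
  also have "\<dots> \<le> 1 / 2 * \<bar>of_int N\<bar>"
    using r unfolding q_def by (intro mult_right_mono) auto
  finally have "2 * \<bar>real_of_int u - of_int q * of_int N\<bar> \<le> \<bar>of_int N\<bar>" by simp
  then have "real_of_int (2 * \<bar>u - q * N\<bar>) \<le> of_int \<bar>N\<bar>" by simp
  then show ?thesis unfolding of_int_le_iff by blast
qed

text \<open>Both |r^2 - s^2| and |r s| are at most N^2 / 4, the latter because 2 |r s| \<le> r^2 +
  s^2.\<close>

lemma tau_norm_bound:
  assumes "2 * \<bar>r\<bar> \<le> \<bar>N\<bar>" "2 * \<bar>s\<bar> \<le> \<bar>N\<bar>" "N \<noteq> 0"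
  shows "\<bar>tau_norm r s\<bar> < N * N"
proof -
  have sq: "4 * (t * t) \<le> N * N" if "2 * \<bar>t\<bar> \<le> \<bar>N\<bar>" for t :: int
    using abs_le_square_iff[of "2 * t" N] that by (simp add: power2_eq_square abs_mult)
  have "N * N > 0" using assms(3) by (simp add: zero_less_mult_iff) linarith
  moreover have "2 * (r * s) \<le> r * r + s * s" "- (2 * (r * s)) \<le> r * r + s * s"
    using zero_le_square[of "r - s"] zero_le_square[of "r + s"] by (simp_all add: algebra_simps)
  ultimately show ?thesis
    using sq[OF assms(1)] sq[OF assms(2)] zero_le_square[of r] zero_le_square[of s]
    unfolding tau_norm_def by linarith
qed

text \<open>The exact quotient is \<open>(u + v * tau) / N\<close>; rounding both coordinates to
  nearest integers gives \<open>p + q * tau\<close>.\<close>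

lemma Z_tau_division:
  assumes "tau_norm c d \<noteq> 0"
  shows "\<exists>q\<in>Z_tau. \<exists>r s. of_int a + of_int b * tau =
    q * (of_int c + of_int d * tau) + (of_int r + of_int s * tau) \<and>
    \<bar>tau_norm r s\<bar> < \<bar>tau_norm c d\<bar>"
proof -
  define N where "N = tau_norm c d"
  have N: "N \<noteq> 0" using assms by (simp add: N_def)
  \<comment> \<open>\<open>u + v \<tau>\<close> is the dividend times the conjugate \<open>(c + d) - d \<tau>\<close> of the divisor.\<close>
  define u where "u = a * (c + d) - b * d"
  define v where "v = b * c - a * d"
  obtain p q where p: "2 * \<bar>u - p * N\<bar> \<le> \<bar>N\<bar>" and q: "2 * \<bar>v - q * N\<bar> \<le> \<bar>N\<bar>"
    using int_nearest_quotient[OF N] by metis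
  define r where "r = a - (p * c + q * d)"
  define s where "s = b - (p * d + q * c + q * d)"
  \<comment> \<open>The left side is the norm of the remainder times the conjugate of the divisor,
    and that conjugate again has norm \<open>N\<close>.\<close>
  have "tau_norm (u - p * N) (v - q * N) = N * tau_norm r s"
    unfolding u_def v_def N_def r_def s_def tau_norm_def by algebra
  then have "\<bar>N\<bar> * \<bar>tau_norm r s\<bar> < \<bar>N\<bar> * \<bar>N\<bar>"
    using tau_norm_bound[OF p q N] by (metis abs_mult abs_mult_self_eq)
  then have "\<bar>tau_norm r s\<bar> < \<bar>N\<bar>" by (rule mult_left_less_imp_less) simp
  moreover have "of_int a + of_int b * tau =
      (of_int p + of_int q * tau) * (of_int c + of_int d * tau) + (of_int r + of_int s * tau)"
    unfolding tau_mult r_def s_def by (simp add: algebra_simps)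
  ultimately show ?thesis unfolding N_def using Z_tau_I by blast
qed

text \<open>Euclid's algorithm, by induction on the absolute norm of the second entry. The relation
  is stated for the cofactors \<open>m\<close>, \<open>n\<close> rather than for \<open>g\<close>,
  so that they are coprime even when \<open>x = y = 0\<close>.\<close>

lemma Z_tau_bezout:
  assumes "x \<in> Z_tau" "y \<in> Z_tau"
  shows "\<exists>g\<in>Z_tau. \<exists>m\<in>Z_tau. \<exists>n\<in>Z_tau. \<exists>s\<in>Z_tau. \<exists>t\<in>Z_tau.
    x = g * m \<and> y = g * n \<and> s * m + t * n = 1"
proof -
  have "\<exists>g\<in>Z_tau. \<exists>m\<in>Z_tau. \<exists>n\<in>Z_tau. \<exists>s\<in>Z_tau. \<exists>t\<in>Z_tau.
      x = g * m \<and> of_int c + of_int d * tau = g * n \<and> s * m + t * n = 1"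
    if "x \<in> Z_tau" for x c d
    using that
  proof (induction "nat \<bar>tau_norm c d\<bar>" arbitrary: x c d rule: less_induct)
    case less
    show ?case
    proof (cases "tau_norm c d = 0")
      case True
      then have "c = 0" "d = 0" using tau_norm_eq_0 by blast+
      then have "x = x * 1 \<and> of_int c + of_int d * tau = x * 0 \<and> 1 * 1 + 0 * 0 = (1::real)" by simp
      then show ?thesis using less.prems Z_tau_0 Z_tau_1 by blast
    next
      case False
      define y where "y = of_int c + of_int d * tau"
      obtain a b where ab: "x = of_int a + of_int b * tau" by (rule Z_tau_E[OF less.prems])
      obtain q e f where q: "q \<in> Z_tau" and x: "x = q * y + (of_int e + of_int f * tau)"
        and lt: "\<bar>tau_norm e f\<bar> < \<bar>tau_norm c d\<bar>"
        using Z_tau_division[OF False, of a b] unfolding ab y_def by blast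
      have "nat \<bar>tau_norm e f\<bar> < nat \<bar>tau_norm c d\<bar>" using lt by simp
      moreover have "y \<in> Z_tau" unfolding y_def by (rule Z_tau_I)
      ultimately obtain g m n s t
        where mem: "g \<in> Z_tau" "m \<in> Z_tau" "n \<in> Z_tau" "s \<in> Z_tau" "t \<in> Z_tau"
        and eq: "y = g * m" "of_int e + of_int f * tau = g * n" "s * m + t * n = 1"
        using less.hyps[of e f y] by blast
      \<comment> \<open>The cofactors of the pair (\<open>y\<close>, remainder) are
        \<open>m\<close>, \<open>n\<close>; undoing the division step turns them into
        \<open>n + q * m\<close>, \<open>m\<close> for (\<open>x\<close>, \<open>y\<close>).\<close>
      have "x = g * (n + q * m)" using x eq by (simp add: algebra_simps)
      moreover have "t * (n + q * m) + (s - t * q) * m = 1" using eq(3) by (simp add: algebra_simps)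
      moreover have "n + q * m \<in> Z_tau" "s - t * q \<in> Z_tau" using mem q by simp_all
      ultimately show ?thesis using mem eq(1) unfolding y_def by blast
    qed
  qed
  then show ?thesis using assms by (metis Z_tau_E)
qed

lemma Z_tau_square_product:
  assumes a: "a \<in> Z_tau" and b: "b \<in> Z_tau" and c: "c \<in> Z_tau" and abc: "a * b = c\<^sup>2"
  shows "\<exists>l\<in>Z_tau. \<exists>m\<in>Z_tau. \<exists>n\<in>Z_tau. a = l * m\<^sup>2 \<and> b = l * n\<^sup>2 \<and> c = l * m * n"
proof (cases "a = 0")
  case True
  \<comment> \<open>Here \<open>c = 0\<close> as well. This case is separate because the other one
    cancels \<open>g\<close> and \<open>m\<close>.\<close>
  then have "a = b * 0\<^sup>2 \<and> b = b * 1\<^sup>2 \<and> c = b * 0 * 1" using abc by simp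
  then show ?thesis using b Z_tau_0 Z_tau_1 by blast
next
  case False
  obtain g m n s t where mem: "g \<in> Z_tau" "m \<in> Z_tau" "n \<in> Z_tau" "s \<in> Z_tau" "t \<in> Z_tau"
    and am: "a = g * m" and cn: "c = g * n" and st: "s * m + t * n = 1"
    using Z_tau_bezout[OF a c] by blast
  have nz: "g \<noteq> 0" "m \<noteq> 0" using False am by auto
  have "g * (m * b) = g * (g * n\<^sup>2)" using abc am cn by (simp add: power2_eq_square algebra_simps)
  then have mb: "m * b = g * n\<^sup>2" using nz by simp
  \<comment> \<open>This is \<open>g / m\<close>: multiply \<open>g\<close> by
    \<open>(s * m + t * n)^2 = 1\<close>, expand, and replace \<open>g * n^2\<close> by
    \<open>m * b\<close>, so that every term contains \<open>m\<close>.\<close>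
  define l where "l = g * (s\<^sup>2 * m + 2 * s * t * n) + t\<^sup>2 * b"
  have l: "l \<in> Z_tau" unfolding l_def using mem b by simp
  have "g = g * (s * m + t * n)\<^sup>2" by (simp add: st)
  also have "\<dots> = m * (g * (s\<^sup>2 * m + 2 * s * t * n)) + t\<^sup>2 * (g * n\<^sup>2)"
    by (simp add: power2_eq_square algebra_simps)
  also have "\<dots> = l * m" unfolding mb[symmetric] l_def by (simp add: algebra_simps)
  finally have g: "g = l * m" .
  have "m * b = m * (l * n\<^sup>2)" using mb g by (simp add: algebra_simps)
  then have "b = l * n\<^sup>2" using nz by simp
  then show ?thesis using l mem am cn g by (auto simp: power2_eq_square mult.assoc)
qed

text \<open>Through \<open>w\<close> and \<open>h\<close>, the halves
  \<open>w - h = (z + y) / 2\<close> and \<open>z - (w - h) = (z - y) / 2\<close> lie in the ring.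
  Their product is \<open>h^2\<close>, and their sum and difference recover \<open>z\<close> and
  \<open>y\<close>.\<close>

lemma pythagorean_even_leg:
  assumes z: "z \<in> Z_tau" and eq: "x\<^sup>2 + y\<^sup>2 = z\<^sup>2"
    and h: "h \<in> Z_tau" "x = 2 * h" and w: "w \<in> Z_tau" "x + y + z = 2 * w"
  shows "\<exists>l\<in>Z_tau. \<exists>m\<in>Z_tau. \<exists>n\<in>Z_tau.
    x = 2 * l * m * n \<and> y = l * (m\<^sup>2 - n\<^sup>2) \<and> z = l * (m\<^sup>2 + n\<^sup>2)"
proof -
  have yz: "y = 2 * (w - h) - z" using h w by simp
  have "(w - h) * (z - (w - h)) = h\<^sup>2"
    using eq unfolding yz h(2) by (simp add: power2_eq_square algebra_simps)
  then obtain l m n where mem: "l \<in> Z_tau" "m \<in> Z_tau" "n \<in> Z_tau"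
    and lmn: "w - h = l * m\<^sup>2" "z - (w - h) = l * n\<^sup>2" "h = l * m * n"
    using Z_tau_square_product[of "w - h" "z - (w - h)" h] z h w by auto
  have "z = l * (m\<^sup>2 + n\<^sup>2)" using lmn by (simp add: algebra_simps)
  moreover from this have "y = l * (m\<^sup>2 - n\<^sup>2)" using yz lmn(1) by (simp add: algebra_simps)
  moreover have "x = 2 * l * m * n" using h lmn(3) by simp
  ultimately show ?thesis using mem by blast
qed

theorem theorem3p3:
  fixes x y z :: real
  assumes "x \<in> Z_tau" and "y \<in> Z_tau" and "z \<in> Z_tau"
    and "x\<^sup>2 + y\<^sup>2 = z\<^sup>2"
  shows "\<exists>l\<in>Z_tau. \<exists>m\<in>Z_tau. \<exists>n\<in>Z_tau.
    ((x = 2 * l * m * n \<or> x = - (2 * l * m * n)) \<and> y = l * (m\<^sup>2 - n\<^sup>2) \<and> z = l * (m\<^sup>2 + n\<^sup>2)) \<or>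
    ((y = 2 * l * m * n \<or> y = - (2 * l * m * n)) \<and> x = l * (m\<^sup>2 - n\<^sup>2) \<and> z = l * (m\<^sup>2 + n\<^sup>2))"
proof -
  have "(x + y + z) * (x + y + z) = 2 * (z\<^sup>2 + x * y + y * z + x * z)"
    using assms(4) by (simp add: power2_eq_square algebra_simps)
  then obtain w where w: "w \<in> Z_tau" "x + y + z = 2 * w"
    using two_prime_Z_tau[of "x + y + z" "x + y + z" "z\<^sup>2 + x * y + y * z + x * z"] assms by auto
  have z: "z = 2 * w - x - y" using w by simp
  have "x * y = 2 * (w * (x + y) - w\<^sup>2)"
    using assms(4) unfolding z by (simp add: power2_eq_square algebra_simps)
  then consider h where "h \<in> Z_tau" "x = 2 * h" | h where "h \<in> Z_tau" "y = 2 * h"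
    using two_prime_Z_tau[of x y "w * (x + y) - w\<^sup>2"] assms w by auto
  then show ?thesis
  proof cases
    case 1
    then show ?thesis using pythagorean_even_leg[OF assms(3,4) 1 w] by blast
  next
    case 2
    have "y\<^sup>2 + x\<^sup>2 = z\<^sup>2" "y + x + z = 2 * w" using assms(4) w by simp_all
    then show ?thesis using pythagorean_even_leg[of z y x h w] assms(3) 2 w by blast
  qed
qed

end
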